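(* For every integer $m\geq 1$ and every integer $n\geq m(3m+1)/2$, with all congruences taken modulo $M=3(2m+1)^2$, \[ \begin{aligned} 0 &= p\big(n\mid \text{parts}\not\equiv 0,\,(2m+1)(3m+1),\,(2m+1)(3m+2)\big) \\ &\quad+\sum_{i=1}^m (-1)^i\Big[\,p\Big(n-\tfrac{i(3i-1)}{2}\;\Big|\; \text{parts}\not\equiv 0,\,(2m+1)(3m-3i+2),\,(2m+1)(3m+3i+1)\Big) \\ &\qquad\qquad\qquad + p\Big(n-\tfrac{i(3i+1)}{2}\;\Big|\; \text{parts}\not\equiv 0,\,(2m+1)(3m-3i+1),\,(2m+1)(3m+3i+2)\Big)\Big]. \end{aligned} \]
   Context: A partition of a non-negative integer $N$ is a way of writing $N$ as a sum of positive integers (parts), where order of the parts does not matter; the integer $0$ has exactly one partition (the empty one). For integers $a,b,c$ and a modulus $M\geq 1$, $p(N\mid \text{parts}\not\equiv a,b,c \pmod{M})$ denotes the number of partitions of $N$ in which no part is congruent to $a$, $b$, or $c$ modulo $M$. *)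

theory Defs
  imports "HOL-Library.Multiset" "HOL-Number_Theory.Cong"
begin

definition partitions :: "nat \<Rightarrow> nat multiset set" where
  "partitions N = {P. 0 \<notin># P \<and> sum_mset P = N}"

lemma finite_partitions: "finite (partitions N)"
proof (rule finite_subset)
  have size: "size P \<le> sum_mset P" if "0 \<notin># P" for P :: "nat multiset"
    using that by (induction P) auto
  show "partitions N \<subseteq> mset ` {xs. set xs \<subseteq> {..N} \<and> length xs \<le> N}"
  proof
    fix P assume "P \<in> partitions N"
    then have P: "0 \<notin># P" "sum_mset P = N"
      by (auto simp: partitions_def)
    obtain xs where xs: "mset xs = P"
      using ex_mset by blast
    have "x \<le> N" if "x \<in># P" for x
      using that P(2) by (metis le_add1 multi_member_split sum_mset.add_mset)
    then show "P \<in> mset ` {xs. set xs \<subseteq> {..N} \<and> length xs \<le> N}"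
      using xs P size[OF P(1)] by (intro image_eqI[of _ _ xs]) auto
  qed
  show "finite (mset ` {xs. set xs \<subseteq> {..N} \<and> length xs \<le> N})"
    by (intro finite_imageI finite_lists_length_le) simp
qed

definition p_avoiding :: "nat \<Rightarrow> int \<Rightarrow> int \<Rightarrow> int \<Rightarrow> int \<Rightarrow> nat" where
  "p_avoiding N a b c M = card {P \<in> partitions N. \<forall>k \<in># P.
     \<not> [int k = a] (mod M) \<and> \<not> [int k = b] (mod M) \<and> \<not> [int k = c] (mod M)}"

end

theory Submission
  imports Defs "HOL-Computational_Algebra.Formal_Power_Series"
begin

text \<open>
  Put $k = 2m+1$. Splitting the sum in Euler's pentagonal number theorem,
  $(q;q)_\infty = \sum_l (-1)^l q^{l(3l-1)/2}$, according to $l = kj + i$ with $|i| \le m$ gives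
  $\sum_{i=-m}^{m} (-1)^i q^{i(3i-1)/2} \sum_j (-1)^j q^{3k^2 j(j-1)/2 + k(3m+3i+1)j}$.
  By the Jacobi triple product each inner sum is the product of $1 - q^l$ over all
  $l \equiv 0, \pm k(3m+3i+1)$ modulo $3k^2$. Dividing by $(q;q)_\infty$ turns it into the
  generating function of the partitions avoiding these residues, so the alternating sum of these
  generating functions is $1$.

  Infinite products are avoided: all identities are congruences modulo $q^K$ between finite products
  and finite sums, and the triple product comes from the finite $q$-binomial theorem.
\<close>

section \<open>The q-binomial theorem\<close>

text \<open>Gaussian binomial coefficients through the q-Pascal rule: without division, any
  commutative ring will do. Truncation in \<open>n - k\<close> is harmless, since
  \<open>qbinomial q n k\<close> vanishes for k > n.\<close>

fun qbinomial :: "'a::comm_ring_1 \<Rightarrow> nat \<Rightarrow> nat \<Rightarrow> 'a" where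
  "qbinomial q n 0 = 1"
| "qbinomial q 0 (Suc k) = 0"
| "qbinomial q (Suc n) (Suc k) = qbinomial q n (Suc k) + q ^ (n - k) * qbinomial q n k"

text \<open>The q-Pochhammer symbol (q;q)_n, that is, the q-factorial without the denominators (1 -
  q)^n.\<close>

definition qfact :: "'a::comm_ring_1 \<Rightarrow> nat \<Rightarrow> 'a" where
  "qfact q n = (\<Prod>i=1..n. 1 - q ^ i)"

lemma qfact_0 [simp]: "qfact q 0 = 1"
  by (simp add: qfact_def)

lemma qfact_Suc: "qfact q (Suc n) = qfact q n * (1 - q ^ Suc n)"
  by (simp add: qfact_def prod.nat_ivl_Suc')

lemma qbinomial_eq_0 [simp]: "n < k \<Longrightarrow> qbinomial q n k = 0"
  by (induction q n k rule: qbinomial.induct) auto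

text \<open>Quotient formula with denominators cleared. By the q-Pascal rule the inductive step
  comes down to (1 - q^(d+1)) + q^(d+1) (1 - q^(l+1)) = 1 - q^(l+d+2).\<close>

lemma qbinomial_mult_qfact:
  "k \<le> n \<Longrightarrow> qbinomial q n k * (qfact q k * qfact q (n - k)) = qfact q n"
proof (induction n arbitrary: k)
  case (Suc n)
  show ?case
  proof (cases k)
    case (Suc l)
    show ?thesis
    proof (cases "l = n")
      case True
      with Suc.IH[of n] \<open>k = Suc l\<close> show ?thesis
        by (simp add: qfact_Suc algebra_simps)
    next
      case False
      with Suc.prems \<open>k = Suc l\<close> obtain d where d: "n = Suc (l + d)"
        by (metis Suc_le_mono add_Suc_right le_neq_implies_less less_imp_Suc_add)
      have 1: "qbinomial q n (Suc l) * (qfact q (Suc l) * qfact q d) = qfact q n"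
        using Suc.IH[of "Suc l"] d by simp
      have 2: "qbinomial q n l * (qfact q l * qfact q (Suc d)) = qfact q n"
        using Suc.IH[of l] d by simp
      have "qbinomial q (Suc n) k * (qfact q k * qfact q (Suc n - k)) =
          (qbinomial q n (Suc l) * (qfact q (Suc l) * qfact q d)) * (1 - q ^ Suc d)
        + q ^ Suc d * (qbinomial q n l * (qfact q l * qfact q (Suc d))) * (1 - q ^ Suc l)"
        using d \<open>k = Suc l\<close> by (simp add: qfact_Suc algebra_simps)
      also have "\<dots> = qfact q n * ((1 - q ^ Suc d) + q ^ Suc d * (1 - q ^ Suc l))"
        unfolding 1 2 by (simp add: algebra_simps)
      also have "\<dots> = qfact q (Suc n)"
        using d by (simp add: qfact_Suc algebra_simps power_add)
      finally show ?thesis .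
    qed
  qed simp
qed simp

lemma Suc_choose_2: "Suc k choose 2 = k + (k choose 2)"
  by (simp add: numeral_2_eq_2)

theorem qbinomial_theorem:
  fixes x y q :: "'a::comm_ring_1"
  shows "(\<Prod>i<n. y + x * q ^ i) =
    (\<Sum>k\<le>n. q ^ (k choose 2) * qbinomial q n k * x ^ k * y ^ (n - k))"
proof (induction n)
  case (Suc n)
  let ?f = "\<lambda>n k. q ^ (k choose 2) * qbinomial q n k * x ^ k * y ^ (n - k)"
  \<comment> \<open>Multiplying by the new factor y + x q^n matches the q-Pascal rule because (k+1
    choose 2) + (n - k) = (k choose 2) + n.\<close>
  have step: "?f (Suc n) (Suc k) = ?f n (Suc k) * y + ?f n k * (x * q ^ n)" if "k \<le> n" for k
  proof (cases "k = n")
    case True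
    then show ?thesis by (simp add: Suc_choose_2 power_add algebra_simps)
  next
    case False
    with that obtain d where d: "n = Suc (k + d)"
      by (metis le_neq_implies_less less_imp_Suc_add)
    then show ?thesis by (simp add: Suc_choose_2 power_add algebra_simps)
  qed
  have "(\<Sum>k\<le>Suc n. ?f (Suc n) k) = y ^ Suc n + (\<Sum>k\<le>n. ?f (Suc n) (Suc k))"
    by (subst sum.atMost_Suc_shift) (simp add: binomial_eq_0)
  also have "(\<Sum>k\<le>n. ?f (Suc n) (Suc k)) =
      (\<Sum>k\<le>n. ?f n (Suc k) * y) + (\<Sum>k\<le>n. ?f n k * (x * q ^ n))"
    unfolding sum.distrib[symmetric] by (intro sum.cong refl step) simp
  also have "y ^ Suc n + ((\<Sum>k\<le>n. ?f n (Suc k) * y) + (\<Sum>k\<le>n. ?f n k * (x * q ^ n))) =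
      (\<Sum>k\<le>Suc n. ?f n k * y) + (\<Sum>k\<le>n. ?f n k * (x * q ^ n))"
    by (subst sum.atMost_Suc_shift) (simp add: binomial_eq_0)
  also have "(\<Sum>k\<le>Suc n. ?f n k * y) = (\<Sum>k\<le>n. ?f n k * y)"
    by simp
  also have "(\<Sum>k\<le>n. ?f n k * y) + (\<Sum>k\<le>n. ?f n k * (x * q ^ n)) =
      (\<Sum>k\<le>n. ?f n k) * (y + x * q ^ n)"
    by (simp add: sum_distrib_right distrib_left sum.distrib)
  finally show ?case
    using Suc.IH by simp
qed (simp add: binomial_eq_0)

section \<open>The truncated Jacobi triple product\<close>

lemma fps_X_power_dvd_iff:
  fixes f :: "'a::comm_ring_1 fps"
  shows "fps_X ^ K dvd f \<longleftrightarrow> (\<forall>i<K. fps_nth f i = 0)"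
proof
  assume "fps_X ^ K dvd f"
  then show "\<forall>i<K. fps_nth f i = 0"
    by (auto elim!: dvdE simp: fps_X_power_mult_nth)
next
  assume "\<forall>i<K. fps_nth f i = 0"
  then have "f = fps_X ^ K * fps_shift K f"
    by (auto simp: fps_eq_iff fps_X_power_mult_nth)
  then show "fps_X ^ K dvd f" by (rule dvdI)
qed

text \<open>A series with constant term 1 has subdegree 0, so multiplying by it does not change the
  order of vanishing. Later this cancels \<open>qfact\<close> and Euler products.\<close>

lemma fps_X_power_dvd_cancel:
  fixes f g :: "'a::idom fps"
  assumes "fps_X ^ K dvd f * g" "fps_nth f 0 = 1"
  shows "fps_X ^ K dvd g"
proof (cases "g = 0")
  case False
  have "f \<noteq> 0" "subdegree f = 0"
    using assms(2) by (auto simp: subdegree_eq_0_iff)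
  with False have "subdegree (f * g) = subdegree g" "f * g \<noteq> 0" by auto
  moreover have "subdegree (f * g) \<ge> K"
    using assms(1) \<open>f * g \<noteq> 0\<close> by (intro subdegree_geI) (auto simp: fps_X_power_dvd_iff)
  ultimately show ?thesis
    by (auto simp: fps_X_power_dvd_iff intro: nth_less_subdegree_zero)
qed simp

definition euler_prod :: "nat set \<Rightarrow> int fps" where
  "euler_prod A = (\<Prod>k\<in>A. 1 - fps_X ^ k)"

lemma euler_prod_nth_0:
  "0 \<notin> A \<Longrightarrow> fps_nth (euler_prod A) 0 = 1"
  unfolding euler_prod_def
  by (induction A rule: infinite_finite_induct) (auto simp: fps_X_power_nth)

lemma euler_prod_cong_1:
  assumes "\<And>k. k \<in> A \<Longrightarrow> K \<le> k"
  shows "fps_X ^ K dvd euler_prod A - 1"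
  using assms unfolding euler_prod_def
proof (induction A rule: infinite_finite_induct)
  case (insert k A)
  have "(\<Prod>k\<in>insert k A. 1 - fps_X ^ k) - 1 =
      ((\<Prod>k\<in>A. 1 - fps_X ^ k) - 1) - fps_X ^ k * (\<Prod>k\<in>A. 1 - fps_X ^ k :: int fps)"
    using insert.hyps by (simp add: algebra_simps)
  moreover have "fps_X ^ K dvd (fps_X ^ k :: int fps)"
    using insert.prems[of k] by (simp add: le_imp_power_dvd)
  ultimately show ?case
    using insert.IH insert.prems by (metis dvd_diff dvd_mult2 insertCI)
qed auto

text \<open>Factors with exponent at least K are congruent to 1, so it does not matter where beyond
  K an infinite product is cut off.\<close>

lemma euler_prod_cong:
  assumes "finite A" "finite B" "\<And>k. k < K \<Longrightarrow> k \<in> A \<longleftrightarrow> k \<in> B"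
  shows "fps_X ^ K dvd euler_prod A - euler_prod B"
proof -
  have split: "euler_prod C = euler_prod (C \<inter> {..<K}) * euler_prod (C - {..<K})" if "finite C" for C
    unfolding euler_prod_def using that by (rule prod.Int_Diff)
  have "A \<inter> {..<K} = B \<inter> {..<K}" using assms(3) by auto
  then have "euler_prod A - euler_prod B =
      euler_prod (B \<inter> {..<K}) * ((euler_prod (A - {..<K}) - 1) - (euler_prod (B - {..<K}) - 1))"
    using split[OF assms(1)] split[OF assms(2)] by (simp add: algebra_simps)
  moreover have "fps_X ^ K dvd euler_prod (A - {..<K}) - 1" "fps_X ^ K dvd euler_prod (B - {..<K}) - 1"
    by (auto intro!: euler_prod_cong_1)
  ultimately show ?thesis by (metis dvd_diff dvd_mult)
qed

text \<open>The argument of \<^const>\<open>nat\<close> is non-negative whenever $r \le M$.\<close>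

definition theta_exp :: "nat \<Rightarrow> nat \<Rightarrow> int \<Rightarrow> nat" where
  "theta_exp M r j = nat (int M * (j * (j - 1) div 2) + int r * j)"

text \<open>Partial sum of the theta series in the triple product, symmetric so as to match 2n
  factors of the q-binomial theorem. \<open>nat \<bar>j\<bar>\<close> only provides a natural
  exponent for the sign (-1)^j.\<close>

definition theta_sum :: "nat \<Rightarrow> nat \<Rightarrow> nat \<Rightarrow> int fps" where
  "theta_sum n M r = (\<Sum>j=-int n..int n. (-1) ^ nat \<bar>j\<bar> * fps_X ^ theta_exp M r j)"

lemma two_times_half_pred: "2 * (j * (j - 1) div 2) = j * (j - 1 :: int)"
  by (rule dvd_mult_div_cancel) auto

text \<open>The growth M(|j| - 1) is what the truncation error needs: in
  \<open>jacobi_triple_product_cong\<close> the j-th term carries a relative error of order M(n -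
  |j| + 1), and the two orders add up to M n.\<close>

lemma theta_exp_lower_bound:
  assumes "r \<le> M"
  shows "int M * (\<bar>j\<bar> - 1) \<le> int M * (j * (j - 1) div 2) + int r * j"
    and "0 \<le> int M * (j * (j - 1) div 2) + int r * j"
proof -
  define t where "t = j * (j - 1) div 2"
  have t: "2 * t = j * (j - 1)" unfolding t_def by (rule two_times_half_pred)
  \<comment> \<open>All bounds on t below are instances of this for i near j: j - 1 and j if j is
    non-negative, j + 1 and j + 2 otherwise.\<close>
  have sq: "0 \<le> i * (i - 1)" for i :: int
    by (cases "i \<le> 0") (auto simp: mult_nonpos_nonpos)
  have "int M * (\<bar>j\<bar> - 1) \<le> int M * t + int r * j \<and> 0 \<le> int M * t + int r * j"
  proof (cases "j \<ge> 0")
    case True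
    have "(j - 1) * ((j - 1) - 1) = 2 * (t - (j - 1))" using t by (simp add: algebra_simps)
    with sq[of "j - 1"] have "0 \<le> 2 * (t - (j - 1))" by metis
    then have "j - 1 \<le> t" by simp
    moreover have "0 \<le> t" using sq[of j] unfolding t[symmetric] by simp
    ultimately show ?thesis using True
      by (auto intro!: add_increasing2 mult_left_mono)
  next
    case False
    have "(j + 1) * ((j + 1) - 1) = 2 * (t + j)" using t by (simp add: algebra_simps)
    with sq[of "j + 1"] have "0 \<le> 2 * (t + j)" by metis
    then have 1: "0 \<le> t + j" by simp
    have "(j + 2) * ((j + 2) - 1) = 2 * (t + 2 * j + 1)" using t by (simp add: algebra_simps)
    with sq[of "j + 2"] have "0 \<le> 2 * (t + 2 * j + 1)" by metis
    then have 2: "- j - 1 \<le> t + j" by simp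
    have 3: "int M * j \<le> int r * j"
      using assms False by (intro mult_right_mono_neg) auto
    have "int M * (\<bar>j\<bar> - 1) \<le> int M * (t + j)" "0 \<le> int M * (t + j)"
      using 1 2 False by (auto intro: mult_left_mono)
    with 3 show ?thesis by (simp add: distrib_left)
  qed
  then show "int M * (\<bar>j\<bar> - 1) \<le> int M * (j * (j - 1) div 2) + int r * j"
    and "0 \<le> int M * (j * (j - 1) div 2) + int r * j"
    by (auto simp: t_def)
qed


lemma two_times_choose_2: "2 * int (k choose 2) = int k * (int k - 1)"
  by (induction k) (auto simp: Suc_choose_2 algebra_simps binomial_eq_0)

lemma prod_lessThan_add:
  "(\<Prod>i<a + b. f i) = (\<Prod>i<a. f i) * (\<Prod>i<b. f (a + i :: nat))"
  by (induction b) (simp_all add: mult.assoc)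

lemma prod_power_lessThan: "(\<Prod>i<n. q ^ i) = q ^ (n choose 2)"
  by (induction n) (simp_all add: Suc_choose_2 power_add binomial_eq_0 mult.commute)

text \<open>Exponent bookkeeping for k = n + j: the left side is the exponent of the k-th term in
  the q-binomial expansion, the right side a part independent of k, to be cancelled, plus the theta
  exponent.\<close>

lemma theta_exp_shift:
  assumes "r \<le> M" "k \<le> 2 * n"
  shows "M * (k choose 2) + r * k + M * n * (2 * n - k) =
    r * n + M * (n choose 2) + M * n * n + theta_exp M r (int k - int n)"
proof -
  define j where "j = int k - int n"
  define t where "t = j * (j - 1) div 2"
  have t: "2 * t = j * (j - 1)" unfolding t_def by (rule two_times_half_pred)
  have "2 * (int (k choose 2) + int n * (2 * int n - int k)) = 2 * (int (n choose 2) + int n * int n + t)"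
    unfolding distrib_left t two_times_choose_2 j_def by (simp add: algebra_simps)
  then have *: "int (k choose 2) + int n * (2 * int n - int k) = int (n choose 2) + int n * int n + t"
    by (subst (asm) mult_cancel_left) simp
  have "int (2 * n - k) = 2 * int n - int k" using assms(2) by simp
  then have "int (M * (k choose 2) + r * k + M * n * (2 * n - k)) =
      int M * (int (k choose 2) + int n * (2 * int n - int k)) + int r * int k"
    unfolding of_nat_add of_nat_mult by (simp add: algebra_simps)
  also have "\<dots> = int (r * n + M * (n choose 2) + M * n * n) + (int M * t + int r * j)"
    unfolding * by (simp add: j_def algebra_simps)
  also have "int M * t + int r * j = int (theta_exp M r j)"
    using theta_exp_lower_bound(2)[OF assms(1), of j] by (simp add: theta_exp_def t_def)
  finally show ?thesis
    unfolding j_def of_nat_add[symmetric] of_nat_eq_iff .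
qed

lemma minus_one_power_nat_abs: "(-1) ^ nat \<bar>j\<bar> = (if even j then 1 else -1 :: 'a::ring_1)"
  by (simp add: minus_one_power_iff even_nat_iff)

text \<open>
  This is the homogeneous $q$-binomial theorem for $\prod_{i<2n} (y + x Q^i)$ at $Q = q^M$, $y = Q^n$,
  $x = -q^r$; both sides carry a common factor $(-1)^n q^C$, which avoids negative powers of $q$.
\<close>

lemma finite_jacobi_triple_product:
  assumes "0 < r" "r < M"
  shows "(\<Prod>i=1..n. 1 - fps_X ^ (M * i - r)) * (\<Prod>i<n. 1 - fps_X ^ (M * i + r)) =
    (\<Sum>j=-int n..int n. (-1) ^ nat \<bar>j\<bar> * fps_X ^ theta_exp M r j *
       qbinomial (fps_X ^ M) (2 * n) (nat (int n + j)) :: int fps)"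
    (is "?P1 * ?P2 = ?S")
proof -
  define Q :: "int fps" where "Q = fps_X ^ M"
  define x :: "int fps" where "x = fps_X ^ r"
  define C where "C = r * n + M * (n choose 2) + M * n * n"
  have XC: "fps_X ^ C = x ^ n * Q ^ (n choose 2) * (Q ^ n) ^ n"
    by (simp add: C_def x_def Q_def power_add power_mult[symmetric] mult_ac)
  \<comment> \<open>In the first n factors the smaller power is x Q^i, since r \<le> M (n - i); in
    the last n it is Q^n. Pulling these out leaves the two products and, up to sign, the monomial of
    degree C.\<close>
  have "(\<Prod>i<n. Q ^ n - x * Q ^ i) = (\<Prod>i<n. - x * Q ^ i * (1 - fps_X ^ (M * (n - i) - r)))"
  proof (rule prod.cong)
    fix i assume "i \<in> {..<n}"
    then have "r \<le> M * (n - i)" and n: "n = i + (n - i)"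
      using assms by (auto intro: order.trans[of r M])
    then have "x * fps_X ^ (M * (n - i) - r) = Q ^ (n - i)"
      unfolding x_def Q_def power_add[symmetric] power_mult[symmetric] by simp
    moreover have "Q ^ n = Q ^ i * Q ^ (n - i)"
      using n by (metis power_add)
    ultimately show "Q ^ n - x * Q ^ i = - x * Q ^ i * (1 - fps_X ^ (M * (n - i) - r))"
      by (simp add: algebra_simps)
  qed simp
  also have "\<dots> = (- 1) ^ n * x ^ n * Q ^ (n choose 2) * (\<Prod>i<n. 1 - fps_X ^ (M * (n - i) - r))"
    by (simp add: prod.distrib prod_power_lessThan power_minus[of x] prod_uminus power_mult_distrib)
  also have "(\<Prod>i<n. 1 - fps_X ^ (M * (n - i) - r)) = ?P1"
    by (rule prod.reindex_bij_witness[of _ "\<lambda>i. n - i" "\<lambda>i. n - i"]) auto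
  finally have 1: "(\<Prod>i<n. Q ^ n - x * Q ^ i) = (- 1) ^ n * x ^ n * Q ^ (n choose 2) * ?P1" .
  have "(\<Prod>i<n. Q ^ n - x * Q ^ (n + i)) = (\<Prod>i<n. Q ^ n * (1 - fps_X ^ (M * i + r)))"
    by (intro prod.cong) (simp_all add: x_def Q_def power_add power_mult[symmetric] algebra_simps)
  also have "\<dots> = (Q ^ n) ^ n * ?P2"
    by (simp add: prod.distrib)
  finally have 2: "(\<Prod>i<n. Q ^ n - x * Q ^ (n + i)) = (Q ^ n) ^ n * ?P2" .
  have "(- 1) ^ n * fps_X ^ C * (?P1 * ?P2) = (\<Prod>i<n + n. Q ^ n + - x * Q ^ i)"
    unfolding prod_lessThan_add XC using 1 2 by (simp add: mult_ac)
  also have "\<dots> = (\<Sum>k\<le>n + n. Q ^ (k choose 2) * qbinomial Q (n + n) k * (- x) ^ k * (Q ^ n) ^ (n + n - k))"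
    by (rule qbinomial_theorem)
  also have "\<dots> = (\<Sum>j=-int n..int n. (- 1) ^ n * fps_X ^ C * ((-1) ^ nat \<bar>j\<bar> * fps_X ^ theta_exp M r j *
       qbinomial Q (2 * n) (nat (int n + j))))"
  proof (rule sum.reindex_bij_witness[of _ "\<lambda>j. nat (int n + j)" "\<lambda>k. int k - int n"])
    fix k assume "k \<in> {..n + n}"
    then have k: "k \<le> 2 * n" by simp
    have sign: "(-1) ^ k = (- 1 :: int fps) ^ n * (-1) ^ nat \<bar>int k - int n\<bar>"
      unfolding minus_one_power_nat_abs by (simp add: minus_one_power_iff)
    have "Q ^ (k choose 2) * x ^ k * (Q ^ n) ^ (n + n - k) =
        fps_X ^ (M * (k choose 2) + r * k + M * n * (2 * n - k))"
      by (simp add: Q_def x_def power_add power_mult[symmetric] mult_2)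
    also have "\<dots> = fps_X ^ C * fps_X ^ theta_exp M r (int k - int n)"
      using theta_exp_shift[of r M k n] k assms by (simp only: C_def power_add less_imp_le)
    finally have T: "Q ^ (k choose 2) * qbinomial Q (n + n) k * (- x) ^ k * (Q ^ n) ^ (n + n - k) =
        (-1) ^ k * (fps_X ^ C * fps_X ^ theta_exp M r (int k - int n)) * qbinomial Q (n + n) k"
      unfolding power_minus[of x] by (simp add: mult_ac)
    show "(- 1) ^ n * fps_X ^ C * ((-1) ^ nat \<bar>int k - int n\<bar> *
       fps_X ^ theta_exp M r (int k - int n) * qbinomial Q (2 * n) (nat (int n + (int k - int n)))) =
       Q ^ (k choose 2) * qbinomial Q (n + n) k * (- x) ^ k * (Q ^ n) ^ (n + n - k)"
      unfolding T sign mult_2 by (simp add: mult_ac)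
  qed auto
  also have "\<dots> = (- 1) ^ n * fps_X ^ C * ?S"
    by (simp add: sum_distrib_left Q_def)
  \<comment> \<open>\<open>int fps\<close> is an integral domain, so the nonzero common factor
    (-1)^n q^C cancels.\<close>
  finally show ?thesis
    by simp
qed

section \<open>From the finite triple product to a congruence\<close>

lemma qfact_cong:
  assumes "d \<le> a"
  shows "q ^ Suc d dvd qfact q a - qfact q d"
  using assms
proof (induction a rule: dec_induct)
  case (step a)
  have "qfact q (Suc a) - qfact q d = (qfact q a - qfact q d) - q ^ Suc a * qfact q a"
    by (simp add: qfact_Suc algebra_simps)
  moreover have "q ^ Suc d dvd q ^ Suc a"
    using step.hyps by (intro le_imp_power_dvd) auto
  ultimately show ?case
    using step.IH by (metis dvd_diff dvd_mult2)
qed simp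

lemma qfact_nth_0:
  "0 < M \<Longrightarrow> fps_nth (qfact (fps_X ^ M :: int fps) d) 0 = 1"
  by (induction d) (simp_all add: qfact_Suc power_mult[symmetric] power_add[symmetric] fps_X_power_nth)

text \<open>Here d is the smaller of n + j and n - j. Each of (Q;Q)_n, (Q;Q)_e and (Q;Q)_(2n) agrees
  with (Q;Q)_d modulo Q^(d+1), so G (Q;Q)_d (Q;Q)_e = (Q;Q)_(2n) gives the claim after cancelling
  (Q;Q)_d.\<close>

lemma central_qbinomial_cong:
  fixes Q :: "int fps"
  assumes "0 < M" "Q = fps_X ^ M" "\<bar>j\<bar> + int d = int n"
  shows "Q ^ Suc d dvd qfact Q n * qbinomial Q (2 * n) (nat (int n + j)) - 1"
proof -
  define k where "k = nat (int n + j)"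
  define e where "e = 2 * n - d"
  define G where "G = qbinomial Q (2 * n) k"
  have "k \<le> 2 * n" "d \<le> n" "d \<le> e" "d \<le> 2 * n" "k = d \<and> 2 * n - k = e \<or> k = e \<and> 2 * n - k = d"
    using assms(3) by (auto simp: k_def e_def)
  then have G: "G * qfact Q d * qfact Q e = qfact Q (2 * n)"
    using qbinomial_mult_qfact[of k "2 * n" Q] by (auto simp: G_def mult_ac)
  have "Q ^ Suc d dvd (qfact Q n - qfact Q d) - (qfact Q e - qfact Q d)"
    by (intro dvd_diff qfact_cong) fact+
  then have "Q ^ Suc d dvd G * qfact Q d * (qfact Q n - qfact Q e) + (qfact Q (2 * n) - qfact Q d)"
    using \<open>d \<le> 2 * n\<close> by (intro dvd_add qfact_cong dvd_mult) simp_all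
  also have "\<dots> = qfact Q d * (qfact Q n * G - 1)"
    unfolding G[symmetric] by (simp add: algebra_simps)
  finally have "fps_X ^ (M * Suc d) dvd qfact Q d * (qfact Q n * G - 1)"
    by (simp only: assms(2) power_mult)
  then have "fps_X ^ (M * Suc d) dvd qfact Q n * G - 1"
    by (rule fps_X_power_dvd_cancel) (simp add: assms qfact_nth_0)
  then show ?thesis
    by (simp only: G_def k_def assms(2) power_mult)
qed

lemma jacobi_triple_product_cong:
  assumes "0 < r" "r < M"
  shows "fps_X ^ (M * n) dvd
    qfact (fps_X ^ M) n * ((\<Prod>i=1..n. 1 - fps_X ^ (M * i - r)) * (\<Prod>i<n. 1 - fps_X ^ (M * i + r)))
    - theta_sum n M r"
proof -
  define Q :: "int fps" where "Q = fps_X ^ M"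
  have term_dvd: "fps_X ^ (M * n) dvd fps_X ^ theta_exp M r j *
      (qfact Q n * qbinomial Q (2 * n) (nat (int n + j)) - 1)"
    if "j \<in> {-int n..int n}" for j
  proof -
    define d where "d = n - nat \<bar>j\<bar>"
    have d: "\<bar>j\<bar> + int d = int n" using that by (auto simp: d_def)
    \<comment> \<open>Order of the monomial plus order of the error: (|j| - 1) + (d + 1) = n, times
      M.\<close>
    have "int (M * n) = int M * (\<bar>j\<bar> - 1) + int (M * Suc d)"
      unfolding of_nat_mult d[symmetric] by (simp add: algebra_simps)
    also have "\<dots> \<le> int (theta_exp M r j + M * Suc d)"
      using theta_exp_lower_bound[of r M j] assms by (simp add: theta_exp_def)
    finally have "M * n \<le> theta_exp M r j + M * Suc d"
      by (simp only: of_nat_le_iff)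
    then have "(fps_X :: int fps) ^ (M * n) dvd fps_X ^ theta_exp M r j * fps_X ^ (M * Suc d)"
      unfolding power_add[symmetric] by (rule le_imp_power_dvd)
    also have "fps_X ^ theta_exp M r j * fps_X ^ (M * Suc d) = fps_X ^ theta_exp M r j * Q ^ Suc d"
      by (simp only: Q_def power_mult)
    also have "\<dots> dvd fps_X ^ theta_exp M r j *
      (qfact Q n * qbinomial Q (2 * n) (nat (int n + j)) - 1)"
      using central_qbinomial_cong[of M Q j d n] d assms by (intro mult_dvd_mono) (auto simp: Q_def)
    finally show ?thesis .
  qed
  have "fps_X ^ (M * n) dvd (\<Sum>j=-int n..int n. (-1) ^ nat \<bar>j\<bar> * (fps_X ^ theta_exp M r j *
      (qfact Q n * qbinomial Q (2 * n) (nat (int n + j)) - 1)))"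
    by (intro dvd_sum dvd_mult[OF term_dvd])
  also have "\<dots> = qfact Q n * (\<Sum>j=-int n..int n. (-1) ^ nat \<bar>j\<bar> * fps_X ^ theta_exp M r j *
       qbinomial Q (2 * n) (nat (int n + j))) - theta_sum n M r"
    unfolding theta_sum_def sum_distrib_left sum_subtractf[symmetric]
    by (intro sum.cong) (simp_all add: algebra_simps)
  finally show ?thesis
    unfolding finite_jacobi_triple_product[OF assms] Q_def .
qed

section \<open>The triple product as a product over residue classes\<close>

definition residue_set :: "nat \<Rightarrow> nat \<Rightarrow> nat set" where
  "residue_set M r = {k. k mod M = 0 \<or> k mod M = r \<or> k mod M = M - r}"

text \<open>The three factors of the triple product run over exponents in the classes 0, -r and r.
  The condition 2r \<noteq> M keeps the last two apart, so no exponent is counted twice.\<close>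

lemma euler_prod_residue_set_cong:
  assumes "0 < r" "r < M" "2 * r \<noteq> M" "K \<le> L" "K \<le> n"
  shows "fps_X ^ K dvd euler_prod ({1..L} \<inter> residue_set M r) - theta_sum n M r"
proof -
  define A1 where "A1 = (\<lambda>i. M * i) ` {1..n}"
  define A2 where "A2 = (\<lambda>i. M * i - r) ` {1..n}"
  define A3 where "A3 = (\<lambda>i. M * i + r) ` {..<n}"
  have shift: "M * i - r = M * (i - 1) + (M - r)" if "1 \<le> i" for i
    using that assms by (cases i) auto
  have mods: "M * i mod M = 0" "(M * i + r) mod M = r" "(M * i + (M - r)) mod M = M - r" for i
    unfolding mod_mult_self4 using assms by simp_all
  have res1: "k mod M = 0" if "k \<in> A1" for k
    using that by (auto simp: A1_def)
  have res2: "k mod M = M - r" if "k \<in> A2" for k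
    using that mods(3) unfolding A2_def by (metis (no_types, lifting) atLeastAtMost_iff imageE shift)
  have res3: "k mod M = r" if "k \<in> A3" for k
    using that assms by (auto simp: A3_def)
  have disj: "A1 \<inter> A2 = {}" "(A1 \<union> A2) \<inter> A3 = {}"
  proof -
    have "M - r \<noteq> 0" "M - r \<noteq> r" "r \<noteq> 0" using assms by auto
    then show "A1 \<inter> A2 = {}" "(A1 \<union> A2) \<inter> A3 = {}"
      using res1 res2 res3 unfolding disjoint_iff Un_iff by metis+
  qed
  have fin: "finite A1" "finite A2" "finite A3"
    by (auto simp: A1_def A2_def A3_def)
  have inj2: "inj_on (\<lambda>i. M * i - r) {1..n}"
  proof (rule inj_onI)
    fix x y assume xy: "x \<in> {1..n}" "y \<in> {1..n}" "M * x - r = M * y - r"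
    then have "M * (x - 1) + (M - r) = M * (y - 1) + (M - r)"
      by (simp only: shift atLeastAtMost_iff)
    then have "x - 1 = y - 1"
      using assms unfolding add_right_cancel by simp
    with xy show "x = y" by auto
  qed
  have "euler_prod (A1 \<union> A2 \<union> A3) = euler_prod A1 * (euler_prod A2 * euler_prod A3)"
    unfolding euler_prod_def using disj fin by (simp add: prod.union_disjoint mult.assoc)
  also have "euler_prod A1 = qfact (fps_X ^ M) n"
    unfolding euler_prod_def A1_def qfact_def using assms
    by (subst prod.reindex) (auto simp: inj_on_def power_mult)
  also have "euler_prod A2 = (\<Prod>i=1..n. 1 - fps_X ^ (M * i - r))"
    unfolding euler_prod_def A2_def by (subst prod.reindex[OF inj2]) simp
  also have "euler_prod A3 = (\<Prod>i<n. 1 - fps_X ^ (M * i + r))"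
    unfolding euler_prod_def A3_def using assms by (subst prod.reindex) (auto simp: inj_on_def)
  finally have "fps_X ^ (M * n) dvd euler_prod (A1 \<union> A2 \<union> A3) - theta_sum n M r"
    using jacobi_triple_product_cong[OF assms(1,2)] by simp
  moreover have "(fps_X :: int fps) ^ K dvd fps_X ^ (M * n)"
    using assms by (intro le_imp_power_dvd) (metis le_trans mult_le_mono1 mult_1 Suc_leI le_less_trans One_nat_def zero_le)
  ultimately have 1: "fps_X ^ K dvd euler_prod (A1 \<union> A2 \<union> A3) - theta_sum n M r"
    by (rule dvd_trans[rotated])
  have "k \<in> {1..L} \<inter> residue_set M r \<longleftrightarrow> k \<in> A1 \<union> A2 \<union> A3" if "k < K" for k
  proof
    assume k: "k \<in> {1..L} \<inter> residue_set M r"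
    define i where "i = k div M"
    have i: "k = M * i + k mod M" by (simp add: i_def)
    \<comment> \<open>From k div M \<le> k < K \<le> n: the n members of each progression cover
      everything below K.\<close>
    have "i < n" using that assms by (metis i_def div_le_dividend le_less_trans less_le_trans)
    from k consider "k mod M = 0" | "k mod M = r" | "k mod M = M - r"
      by (auto simp: residue_set_def)
    then show "k \<in> A1 \<union> A2 \<union> A3"
    proof cases
      case 1
      with k i have "k = M * i" "1 \<le> i" by (auto simp: Suc_le_eq)
      with \<open>i < n\<close> show ?thesis by (auto simp: A1_def)
    next
      case 2
      with \<open>i < n\<close> i show ?thesis by (auto simp: A3_def)
    next
      case 3
      then have "k = M * Suc i - r" using i assms by (subst shift) simp_all
      with \<open>i < n\<close> show ?thesis unfolding A2_def by (intro UnI1 UnI2 image_eqI[of _ _ "Suc i"]) auto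
    qed
  next
    assume k: "k \<in> A1 \<union> A2 \<union> A3"
    then have "0 < k" using assms by (auto simp: A1_def A2_def A3_def shift)
    then show "k \<in> {1..L} \<inter> residue_set M r"
      using k that assms res1 res2 res3 by (auto simp: residue_set_def)
  qed
  then have "fps_X ^ K dvd euler_prod ({1..L} \<inter> residue_set M r) - euler_prod (A1 \<union> A2 \<union> A3)"
    using fin by (intro euler_prod_cong) auto
  from dvd_add[OF this 1] show ?thesis by simp
qed


section \<open>Generating functions of restricted partitions\<close>

definition restricted_partitions :: "nat set \<Rightarrow> nat \<Rightarrow> nat multiset set" where
  "restricted_partitions S N = {P \<in> partitions N. set_mset P \<subseteq> S}"

definition partition_gf :: "nat set \<Rightarrow> int fps" where
  "partition_gf S = Abs_fps (\<lambda>N. int (card (restricted_partitions S N)))"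

lemma finite_restricted_partitions: "finite (restricted_partitions S N)"
  unfolding restricted_partitions_def using finite_partitions by simp

lemma partition_gf_empty: "partition_gf {} = 1"
proof -
  have "restricted_partitions {} N = (if N = 0 then {{#}} else {})" for N
    by (auto simp: restricted_partitions_def partitions_def)
  then show ?thesis by (simp add: partition_gf_def fps_eq_iff)
qed

text \<open>Either k is not a part, or removing one copy of k leaves a partition of N - k in which k
  may still occur.\<close>

lemma card_restricted_partitions_insert:
  assumes "0 < k" "k \<notin> S"
  shows "card (restricted_partitions (insert k S) N) = card (restricted_partitions S N) +
    (if k \<le> N then card (restricted_partitions (insert k S) (N - k)) else 0)"
proof -
  let ?T = "if k \<le> N then add_mset k ` restricted_partitions (insert k S) (N - k) else {}"
  have "restricted_partitions (insert k S) N = restricted_partitions S N \<union> ?T"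
  proof (intro equalityI subsetI)
    fix P assume P: "P \<in> restricted_partitions (insert k S) N"
    show "P \<in> restricted_partitions S N \<union> ?T"
    proof (cases "k \<in># P")
      case True
      then obtain P' where P': "P = add_mset k P'" by (metis multi_member_split)
      with P have "k \<le> N" "P' \<in> restricted_partitions (insert k S) (N - k)"
        by (auto simp: restricted_partitions_def partitions_def)
      with P' show ?thesis by auto
    next
      case False
      with P show ?thesis by (auto simp: restricted_partitions_def)
    qed
  next
    fix P assume "P \<in> restricted_partitions S N \<union> ?T"
    then show "P \<in> restricted_partitions (insert k S) N"
      using assms by (auto simp: restricted_partitions_def partitions_def split: if_splits)
  qed
  moreover have "restricted_partitions S N \<inter> ?T = {}"
    using assms by (auto simp: restricted_partitions_def)
  ultimately show ?thesis
    by (simp add: card_Un_disjoint finite_restricted_partitions card_image inj_on_def)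
qed

lemma partition_gf_insert:
  assumes "0 < k" "k \<notin> S"
  shows "partition_gf (insert k S) * (1 - fps_X ^ k) = partition_gf S"
proof (rule fps_ext)
  fix N
  show "fps_nth (partition_gf (insert k S) * (1 - fps_X ^ k)) N = fps_nth (partition_gf S) N"
    using card_restricted_partitions_insert[OF assms, of N]
    by (simp add: partition_gf_def right_diff_distrib fps_X_power_mult_right_nth)
qed

text \<open>Induction on S: admitting a new part k divides the generating function by 1 -
  q^k.\<close>

lemma partition_gf_mult_euler_prod:
  assumes "finite S" "0 \<notin> S"
  shows "partition_gf S * euler_prod S = 1"
  using assms
proof (induction S rule: finite_induct)
  case empty
  then show ?case by (simp add: partition_gf_empty euler_prod_def)
next
  case (insert k S)
  then have "partition_gf (insert k S) * euler_prod (insert k S) =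
      partition_gf (insert k S) * (1 - fps_X ^ k) * euler_prod S"
    by (simp add: euler_prod_def mult.assoc)
  with insert show ?case by (simp add: partition_gf_insert)
qed

text \<open>Parts of a partition of N are at most N, so cutting the allowed parts off at L loses
  nothing. The freedom in L lets one finite set serve several N.\<close>

lemma p_avoiding_eq_partition_gf_nth:
  assumes "0 < r" "r < M" "N \<le> L"
  shows "int (p_avoiding N 0 (int r) (int (M - r)) (int M)) =
    fps_nth (partition_gf ({1..L} - residue_set M r)) N"
proof -
  have cong: "[int k = int a] (mod int M) \<longleftrightarrow> k mod M = a" if "a < M" for k a
    using that unfolding cong_int_iff by (simp add: cong_def)
  have res: "\<not> [int k = 0] (mod int M) \<and> \<not> [int k = int r] (mod int M) \<and>
      \<not> [int k = int (M - r)] (mod int M) \<longleftrightarrow> k \<notin> residue_set M r" for k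
    using cong[of 0 k] cong[of r k] cong[of "M - r" k] assms by (auto simp: residue_set_def)
  have "k \<in> {1..L}" if "P \<in> partitions N" "k \<in># P" for P k
    using that assms(3) by (fastforce simp: partitions_def Suc_le_eq dest!: multi_member_split)
  then have "{P \<in> partitions N. \<forall>k\<in>#P. k \<notin> residue_set M r} =
      restricted_partitions ({1..L} - residue_set M r) N"
    unfolding restricted_partitions_def by blast
  then show ?thesis
    unfolding p_avoiding_def res by (simp add: partition_gf_def)
qed

lemma p_avoiding_swap: "p_avoiding N a b c M = p_avoiding N a c b M"
  unfolding p_avoiding_def by meson

section \<open>Dissection of the pentagonal series\<close>

text \<open>Put k = 2m + 1 and l = kj + i. In l(3l - 1)/2 the term linear in j is k(6i - 1)j/2; the
  right side has the same one because 6m + 2 = 3k - 1.\<close>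

lemma pentagonal_exp_split:
  assumes "\<bar>i\<bar> \<le> int m"
  shows "theta_exp 3 1 ((2 * int m + 1) * j + i) = theta_exp 3 1 i +
    theta_exp (3 * (2 * m + 1) ^ 2) ((2 * m + 1) * nat (3 * int m + 3 * i + 1)) j"
proof -
  define k where "k = 2 * int m + 1"
  define t where "t = j * (j - 1) div 2"
  define u where "u = i * (i - 1) div 2"
  define v where "v = (k * j + i) * (k * j + i - 1) div 2"
  define M where "M = 3 * (2 * m + 1) ^ 2"
  define r where "r = (2 * m + 1) * nat (3 * int m + 3 * i + 1)"
  have "2 * t = j * (j - 1)" "2 * u = i * (i - 1)" "2 * v = (k * j + i) * (k * j + i - 1)"
    unfolding t_def u_def v_def by (rule two_times_half_pred)+
  moreover have M: "int M = 3 * k ^ 2" by (simp add: M_def k_def)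
  moreover have r: "int r = k * (3 * int m + 3 * i + 1)"
    using assms by (simp add: r_def k_def algebra_simps)
  ultimately have "2 * (3 * v + (k * j + i)) = 2 * ((3 * u + i) + (int M * t + int r * j))"
    unfolding k_def by algebra
  then have eq: "3 * v + (k * j + i) = (3 * u + i) + (int M * t + int r * j)"
    by (subst (asm) mult_cancel_left) simp
  \<comment> \<open>The bound r \<le> 3k^2 = M makes the second exponent non-negative, as
    \<open>nat_add_distrib\<close> requires.\<close>
  have "k * (3 * int m + 3 * i + 1) \<le> k * (3 * k)"
    using assms unfolding k_def by (intro mult_left_mono) auto
  then have "int r \<le> int M"
    by (simp add: M r power2_eq_square)
  then have "0 \<le> int M * t + int r * j" "0 \<le> 3 * u + i"
    using theta_exp_lower_bound(2)[of r M j] theta_exp_lower_bound(2)[of 1 3 i]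
    by (simp_all add: t_def u_def)
  with eq have "nat (3 * v + (k * j + i)) = nat (3 * u + i) + nat (int M * t + int r * j)"
    by (simp only: nat_add_distrib)
  then show ?thesis
    unfolding theta_exp_def M_def[symmetric] r_def[symmetric] k_def[symmetric]
    by (simp add: t_def u_def v_def)
qed

text \<open>Division by k = 2m + 1 with balanced remainder: adding m first turns i into an ordinary
  remainder i + m between 0 and 2m. The extreme values of l come from corners of the
  rectangle.\<close>

lemma bij_betw_dissection:
  "bij_betw (\<lambda>(i, j). (2 * int m + 1) * j + i)
     ({-int m..int m} \<times> {-int n..int n})
     {-int ((2 * m + 1) * n + m)..int ((2 * m + 1) * n + m)}"
proof -
  define k where "k = 2 * int m + 1"
  have k: "0 < k" by (simp add: k_def)
  have kn: "int ((2 * m + 1) * n + m) = k * int n + int m" by (simp add: k_def algebra_simps)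
  have div: "(k * j + i + int m) div k = j" "(k * j + i + int m) mod k = i + int m"
    if "i \<in> {-int m..int m}" for i j
  proof -
    have "0 \<le> i + int m" "i + int m < k" using that by (auto simp: k_def)
    then show "(k * j + i + int m) div k = j" "(k * j + i + int m) mod k = i + int m"
      unfolding add.assoc by simp_all
  qed
  show ?thesis
    unfolding kn k_def[symmetric]
  proof (rule bij_betw_byWitness[of _ "\<lambda>l. ((l + int m) mod k - int m, (l + int m) div k)"])
    show "(\<lambda>(i, j). k * j + i) ` ({-int m..int m} \<times> {-int n..int n}) \<subseteq> {-(k * int n + int m)..k * int n + int m}"
    proof clarify
      fix i j assume *: "i \<in> {-int m..int m}" "j \<in> {-int n..int n}"
      have "k * j \<le> k * int n" "k * (- int n) \<le> k * j"
        using * k by (intro mult_left_mono; simp)+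
      then show "k * j + i \<in> {-(k * int n + int m)..k * int n + int m}"
        using * by auto
    qed
  next
    show "(\<lambda>l. ((l + int m) mod k - int m, (l + int m) div k)) ` {-(k * int n + int m)..k * int n + int m}
        \<subseteq> {-int m..int m} \<times> {-int n..int n}"
    proof (rule image_subsetI)
      fix l assume l: "l \<in> {-(k * int n + int m)..k * int n + int m}"
      have "0 \<le> (l + int m) mod k" "(l + int m) mod k < k" using k by simp_all
      moreover have "(k * (- int n)) div k \<le> (l + int m) div k"
        using l k by (intro zdiv_mono1) auto
      moreover have "(k * (- int n)) div k = - int n"
        using k by (subst nonzero_mult_div_cancel_left) auto
      moreover have "(l + int m) div k \<le> (k * int n + 2 * int m) div k"
        using l k by (intro zdiv_mono1) auto
      moreover have "(k * int n + 2 * int m) div k = int n"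
        using div(1)[of "int m" "int n"] by (simp add: add.commute)
      ultimately show "((l + int m) mod k - int m, (l + int m) div k) \<in> {-int m..int m} \<times> {-int n..int n}"
        unfolding mem_Times_iff atLeastAtMost_iff fst_conv snd_conv using k_def by linarith
    qed
  qed (auto simp: div add_diff_eq)
qed

text \<open>The cut-off (2m + 1) n + m makes the index range exactly a rectangle, so the dissection
  is an identity and not just a congruence.\<close>

lemma pentagonal_dissection:
  "theta_sum ((2 * m + 1) * n + m) 3 1 =
    (\<Sum>i=-int m..int m. (-1) ^ nat \<bar>i\<bar> * fps_X ^ theta_exp 3 1 i *
      theta_sum n (3 * (2 * m + 1) ^ 2) ((2 * m + 1) * nat (3 * int m + 3 * i + 1)))"
proof -
  have "theta_sum ((2 * m + 1) * n + m) 3 1 = (\<Sum>(i, j)\<in>{-int m..int m} \<times> {-int n..int n}.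
      (-1) ^ nat \<bar>(2 * int m + 1) * j + i\<bar> * fps_X ^ theta_exp 3 1 ((2 * int m + 1) * j + i))"
    unfolding theta_sum_def
    by (subst sum.reindex_bij_betw[OF bij_betw_dissection, symmetric]) (simp add: case_prod_unfold)
  also have "\<dots> = (\<Sum>i=-int m..int m. \<Sum>j=-int n..int n.
      (-1) ^ nat \<bar>(2 * int m + 1) * j + i\<bar> * fps_X ^ theta_exp 3 1 ((2 * int m + 1) * j + i))"
    by (simp add: sum.cartesian_product)
  also have "\<dots> = (\<Sum>i=-int m..int m. (-1) ^ nat \<bar>i\<bar> * fps_X ^ theta_exp 3 1 i *
      theta_sum n (3 * (2 * m + 1) ^ 2) ((2 * m + 1) * nat (3 * int m + 3 * i + 1)))"
    unfolding theta_sum_def sum_distrib_left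
  proof (intro sum.cong refl)
    fix i j assume "i \<in> {-int m..int m}"
    then have "\<bar>i\<bar> \<le> int m" by auto
    \<comment> \<open>2m + 1 is odd, so (2m + 1) j + i has the parity of i + j.\<close>
    have sign: "(-1 :: int fps) ^ nat \<bar>(2 * int m + 1) * j + i\<bar> = (-1) ^ nat \<bar>i\<bar> * (-1) ^ nat \<bar>j\<bar>"
      unfolding minus_one_power_nat_abs by simp
    show "(-1) ^ nat \<bar>(2 * int m + 1) * j + i\<bar> * fps_X ^ theta_exp 3 1 ((2 * int m + 1) * j + i) =
      (-1) ^ nat \<bar>i\<bar> * fps_X ^ theta_exp 3 1 i * ((-1) ^ nat \<bar>j\<bar> *
        fps_X ^ theta_exp (3 * (2 * m + 1) ^ 2) ((2 * m + 1) * nat (3 * int m + 3 * i + 1)) j :: int fps)"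
      unfolding pentagonal_exp_split[OF \<open>\<bar>i\<bar> \<le> int m\<close>] power_add sign by (simp only: mult_ac)
  qed
  finally show ?thesis .
qed

lemma sum_symmetric_interval:
  "(\<Sum>i=-int m..int m. f i) = f 0 + (\<Sum>i=1..m. f (int i) + f (- int i))"
proof (induction m)
  case (Suc m)
  have "{-int (Suc m)..int (Suc m)} = insert (int (Suc m)) (insert (- int (Suc m)) {-int m..int m})"
    by auto
  then show ?case
    using Suc by (simp add: add_ac)
qed simp

lemma theta_exp_3_1:
  "theta_exp 3 1 (int i) = i * (3 * i - 1) div 2"
  "theta_exp 3 1 (- int i) = i * (3 * i + 1) div 2"
proof -
  have *: "3 * (j * (j - 1) div 2) + j = j * (3 * j - 1) div 2" for j :: int
  proof -
    have "2 * (3 * (j * (j - 1) div 2) + j) = j * (3 * j - 1)"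
      using two_times_half_pred[of j] by algebra
    then show ?thesis
      by (metis nonzero_mult_div_cancel_left zero_neq_numeral)
  qed
  \<comment> \<open>At i = 0 the truncated subtraction 3i - 1 is multiplied by 0.\<close>
  have "int i * (3 * int i - 1) = int (i * (3 * i - 1))"
    by (cases i) (auto simp: algebra_simps)
  then show "theta_exp 3 1 (int i) = i * (3 * i - 1) div 2"
    using *[of "int i"] by (simp add: theta_exp_def nat_div_distrib del: of_nat_mult)
  have "- int i * (3 * - int i - 1) = int (i * (3 * i + 1))"
    by (simp add: algebra_simps)
  then show "theta_exp 3 1 (- int i) = i * (3 * i + 1) div 2"
    using *[of "- int i"] by (simp add: theta_exp_def nat_div_distrib del: of_nat_mult of_nat_add)
qed

text \<open>Multiplied by E, a truncation of (q;q)_infinity, each generating function becomes the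
  product over its forbidden parts, hence a theta sum by the triple product. The dissection adds
  these up to a pentagonal sum congruent to E, and E cancels.\<close>

lemma partition_gf_alternating_sum:
  fixes m K :: nat
  defines "M \<equiv> 3 * (2 * m + 1) ^ 2"
  defines "r \<equiv> \<lambda>i. (2 * m + 1) * nat (3 * int m + 3 * i + 1)"
  shows "fps_X ^ K dvd (\<Sum>i=-int m..int m. (-1) ^ nat \<bar>i\<bar> * fps_X ^ theta_exp 3 1 i *
    partition_gf ({1..K} - residue_set M (r i))) - 1"
proof -
  define E where "E = euler_prod {1..K}"
  define B where "B = (\<lambda>i. euler_prod ({1..K} \<inter> residue_set M (r i)))"
  define G where "G = (\<lambda>i. partition_gf ({1..K} - residue_set M (r i)))"
  define s :: "int \<Rightarrow> int fps" where "s = (\<lambda>i. (-1) ^ nat \<bar>i\<bar> * fps_X ^ theta_exp 3 1 i)"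
  have EG: "E * G i = B i" for i
  proof -
    have "E = B i * euler_prod ({1..K} - residue_set M (r i))"
      unfolding E_def B_def euler_prod_def by (rule prod.Int_Diff) simp
    then show ?thesis
      using partition_gf_mult_euler_prod[of "{1..K} - residue_set M (r i)"]
      by (simp add: G_def mult_ac)
  qed
  \<comment> \<open>The classes 0, 1 and 2 modulo 3 exhaust all numbers, so the triple product with
    modulus 3 and r = 1 is Euler's pentagonal number theorem.\<close>
  have "(k :: nat) \<in> residue_set 3 1" for k
    unfolding residue_set_def by (auto; presburger)
  then have "{1..K} \<inter> residue_set 3 1 = {1..K}" by auto
  then have E: "fps_X ^ K dvd theta_sum ((2 * m + 1) * K + m) 3 1 - E"
    using euler_prod_residue_set_cong[of 1 3 K K "(2 * m + 1) * K + m"]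
    unfolding E_def by (subst minus_diff_eq[symmetric], subst dvd_minus_iff) simp
  have B: "fps_X ^ K dvd B i - theta_sum K M (r i)" if "i \<in> {-int m..int m}" for i
  proof -
    define a where "a = nat (3 * int m + 3 * i + 1)"
    have int_a: "int a = 3 * (int m + i) + 1"
      using that by (simp add: a_def)
    have "- int m \<le> i" "i \<le> int m"
      using that by auto
    with int_a have a: "0 < a" "a < 3 * (2 * m + 1)"
      by presburger+
    \<comment> \<open>As a is 1 modulo 3, 2a cannot equal 3(2m + 1); this will give 2 r \<noteq>
      M.\<close>
    have "\<not> 3 dvd 2 * int a"
      unfolding int_a by presburger
    then have a': "\<not> 3 dvd 2 * a"
      by (metis int_dvd_int_iff of_nat_mult of_nat_numeral)
    have M: "M = (2 * m + 1) * (3 * (2 * m + 1))"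
      by (simp only: M_def power2_eq_square mult.left_commute)
    have ri: "r i = (2 * m + 1) * a" by (simp only: r_def a_def)
    have "r i < M" unfolding ri M by (rule mult_strict_left_mono[OF a(2)]) simp
    moreover have "2 * r i \<noteq> M"
    proof
      assume "2 * r i = M"
      then have "(2 * m + 1) * (2 * a) = (2 * m + 1) * (3 * (2 * m + 1))"
        unfolding M ri by (metis mult.left_commute)
      then have "2 * a = 3 * (2 * m + 1)" by (subst (asm) mult_cancel_left) simp
      with a' show False by (metis dvd_triv_left)
    qed
    moreover have "0 < r i" using a(1) unfolding ri by simp
    ultimately show ?thesis
      unfolding B_def by (intro euler_prod_residue_set_cong) auto
  qed
  have "fps_X ^ K dvd (\<Sum>i=-int m..int m. s i * (B i - theta_sum K M (r i)))
      + (theta_sum ((2 * m + 1) * K + m) 3 1 - E)"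
    by (intro dvd_add dvd_sum dvd_mult[OF B] E)
  also have "theta_sum ((2 * m + 1) * K + m) 3 1 = (\<Sum>i=-int m..int m. s i * theta_sum K M (r i))"
    unfolding pentagonal_dissection s_def M_def r_def ..
  also have "(\<Sum>i=-int m..int m. s i * (B i - theta_sum K M (r i))) +
      ((\<Sum>i=-int m..int m. s i * theta_sum K M (r i)) - E) = E * ((\<Sum>i=-int m..int m. s i * G i) - 1)"
    unfolding right_diff_distrib sum_subtractf sum_distrib_left EG[symmetric] by (simp add: mult_ac)
  finally have "fps_X ^ K dvd (\<Sum>i=-int m..int m. s i * G i) - 1"
    by (rule fps_X_power_dvd_cancel) (simp add: E_def euler_prod_nth_0)
  then show ?thesis
    unfolding s_def G_def .
qed

section \<open>Reading off the coefficient of q^n\<close>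

theorem theorem2:
  fixes m n :: nat and M :: int
  assumes "m \<ge> 1"
    and "n \<ge> m * (3 * m + 1) div 2"
    and "M = 3 * (2 * int m + 1) ^ 2"
  shows "0 =
    int (p_avoiding n
      0 ((2 * int m + 1) * (3 * int m + 1)) ((2 * int m + 1) * (3 * int m + 2)) M)
    + (\<Sum>i = 1..m. (-1) ^ i *
        (int (p_avoiding (n - i * (3 * i - 1) div 2)
           0 ((2 * int m + 1) * (3 * int m - 3 * int i + 2))
             ((2 * int m + 1) * (3 * int m + 3 * int i + 1)) M)
         + int (p_avoiding (n - i * (3 * i + 1) div 2)
           0 ((2 * int m + 1) * (3 * int m - 3 * int i + 1))
             ((2 * int m + 1) * (3 * int m + 3 * int i + 2)) M)))"
proof -
  define k where "k = 2 * int m + 1"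
  define N where "N = 3 * (2 * m + 1) ^ 2"
  define r where "r = (\<lambda>i. (2 * m + 1) * nat (3 * int m + 3 * i + 1))"
  \<comment> \<open>The last residue is M minus the one before it, since 3k - (3m + 3i + 1) = 3m -
    3i + 2.\<close>
  define f where "f = (\<lambda>i. (-1) ^ nat \<bar>i\<bar> *
    int (p_avoiding (n - theta_exp 3 1 i) 0 (k * (3 * int m + 3 * i + 1)) (k * (3 * int m - 3 * i + 2)) M))"
  \<comment> \<open>The lower bound on n enters here: no subtraction from n is truncated.\<close>
  have exp_le: "theta_exp 3 1 i \<le> n" if "i \<in> {-int m..int m}" for i
  proof -
    obtain l where l: "i = int l \<or> i = - int l" "l \<le> m"
      using \<open>i \<in> _\<close> by (cases i rule: int_cases2) auto
    have "l * (3 * l - 1) div 2 \<le> l * (3 * l + 1) div 2"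
      by (intro div_le_mono mult_le_mono) auto
    moreover have "l * (3 * l + 1) div 2 \<le> m * (3 * m + 1) div 2"
      using l(2) by (intro div_le_mono mult_le_mono) auto
    ultimately show ?thesis
      using l(1) assms(2) theta_exp_3_1[of l] by auto
  qed
  \<comment> \<open>The alternating sum of the series is congruent to 1, so its coefficient at n
    vanishes only for n > 0.\<close>
  have "2 \<le> m * (3 * m + 1) div 2"
    using div_le_mono[OF mult_le_mono[of 1 m 4 "3 * m + 1"], of 2] assms(1) by simp
  then have "n \<noteq> 0" using assms(2) by linarith
  have coeff: "fps_nth ((-1) ^ nat \<bar>i\<bar> * fps_X ^ theta_exp 3 1 i *
      partition_gf ({1..Suc n} - residue_set N (r i))) n = f i" if "i \<in> {-int m..int m}" for i
  proof -
    have r: "int (r i) = k * (3 * int m + 3 * i + 1)"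
      using that by (simp add: r_def k_def algebra_simps)
    have N: "int N = k * (3 * k)" "int N = M"
      using assms(3) by (simp_all add: N_def k_def power2_eq_square algebra_simps)
    have "k * 0 < k * (3 * int m + 3 * i + 1)" "k * (3 * int m + 3 * i + 1) < k * (3 * k)"
      using that unfolding k_def by (intro mult_strict_left_mono; simp)+
    then have *: "0 < r i" "r i < N" using r N by linarith+
    have Nr: "int (N - r i) = k * (3 * int m - 3 * i + 2)"
      using *(2) r N(1) by (simp add: of_nat_diff k_def algebra_simps)
    have "f i = (-1) ^ nat \<bar>i\<bar> * fps_nth (partition_gf ({1..Suc n} - residue_set N (r i))) (n - theta_exp 3 1 i)"
      unfolding f_def r[symmetric] Nr[symmetric] N(2)[symmetric]
      by (subst p_avoiding_eq_partition_gf_nth[OF *]) auto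
    then show ?thesis
      using exp_le[OF that] by (simp add: minus_one_power_nat_abs fps_X_power_mult_nth mult.assoc)
  qed
  \<comment> \<open>Precision n + 1 is the least that reaches the coefficient of q^n.\<close>
  have "fps_nth ((\<Sum>i=-int m..int m. (-1) ^ nat \<bar>i\<bar> * fps_X ^ theta_exp 3 1 i *
      partition_gf ({1..Suc n} - residue_set N (r i))) - 1) n = 0"
    using partition_gf_alternating_sum[of "Suc n" m] unfolding fps_X_power_dvd_iff N_def r_def by blast
  then have "(\<Sum>i=-int m..int m. f i) = 0"
    using \<open>n \<noteq> 0\<close> coeff by (simp add: fps_sum_nth)
  then have "0 = f 0 + (\<Sum>i=1..m. f (int i) + f (- int i))"
    by (simp only: sum_symmetric_interval)
  also have "f 0 = int (p_avoiding n 0 (k * (3 * int m + 1)) (k * (3 * int m + 2)) M)"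
    by (simp add: f_def theta_exp_def)
  also have "(\<Sum>i=1..m. f (int i) + f (- int i)) = (\<Sum>i = 1..m. (-1) ^ i *
        (int (p_avoiding (n - i * (3 * i - 1) div 2)
           0 (k * (3 * int m - 3 * int i + 2)) (k * (3 * int m + 3 * int i + 1)) M)
         + int (p_avoiding (n - i * (3 * i + 1) div 2)
           0 (k * (3 * int m - 3 * int i + 1)) (k * (3 * int m + 3 * int i + 2)) M)))"
  proof (intro sum.cong refl)
    fix i
    show "f (int i) + f (- int i) = (-1) ^ i *
        (int (p_avoiding (n - i * (3 * i - 1) div 2)
           0 (k * (3 * int m - 3 * int i + 2)) (k * (3 * int m + 3 * int i + 1)) M)
         + int (p_avoiding (n - i * (3 * i + 1) div 2)
           0 (k * (3 * int m - 3 * int i + 1)) (k * (3 * int m + 3 * int i + 2)) M))"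
      \<comment> \<open>At index i the two nonzero residues come in the opposite order and need a
        swap; at -i they already match.\<close>
      unfolding f_def theta_exp_3_1
      by (subst p_avoiding_swap) (simp add: distrib_left)
  qed
  finally show ?thesis
    unfolding k_def .
qed

end
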